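(* For all fixed parameters $0<\alpha,\beta,\gamma<1$, the stochastic Kronecker graph $K(n,P)$ asymptotically almost surely does not have a power law degree distribution.
   Context: Let $n\in\mathbb N$ and let $0<\alpha,\beta,\gamma<1$ be constants not depending on $n$. Set $P=\begin{pmatrix}\alpha&\beta\\ \beta&\gamma\end{pmatrix}$, indexed by $\{0,1\}$, so $P_{1,1}=\alpha$, $P_{0,1}=P_{1,0}=\beta$, $P_{0,0}=\gamma$. The stochastic Kronecker graph $K(n,P)$ has vertex set $\mathbb Z_2^n$ (binary strings of length $n$); writing $u_k$ for the $k$-th digit of $u$, each pair $\{u,v\}$ is an edge with probability $p_{u,v}=\prod_{k=1}^n P_{u_k,v_k}$, independently of all other pairs. All asymptotics are as $n\to\infty$; a property holds asymptotically almost surely (a.a.s.) if its probability tends to $1$. A graph with vertex set $V$ is said to have a power law degree distribution if there are constants $c>0$ and $\tau$ such that for every fixed $d$ the number of vertices of degree $d$ is approximately $c\,d^{-\tau}|V|$; in particular, for every fixed $d$ the number of vertices of degree $d$ is a linear fraction (i.e. $\Theta(|V|)$) of all vertices. *)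

theory Defs
  imports "HOL-Probability.Probability"
begin

text \<open>Binary digits are represented by \<^typ>\<open>bool\<close>, with \<^term>\<open>True\<close> for 1.\<close>

fun kron_matrix :: "real \<Rightarrow> real \<Rightarrow> real \<Rightarrow> bool \<Rightarrow> bool \<Rightarrow> real" where
  "kron_matrix \<alpha> \<beta> \<gamma> True True = \<alpha>"
| "kron_matrix \<alpha> \<beta> \<gamma> True False = \<beta>"
| "kron_matrix \<alpha> \<beta> \<gamma> False True = \<beta>"
| "kron_matrix \<alpha> \<beta> \<gamma> False False = \<gamma>"

definition kron_verts :: "nat \<Rightarrow> bool list set" where
  "kron_verts n = {u. length u = n}"

definition vertex_pairs :: "'a set \<Rightarrow> 'a set set" where
  "vertex_pairs V = {{u, v} | u v. u \<in> V \<and> v \<in> V \<and> u \<noteq> v}"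

definition kron_prob :: "(bool \<Rightarrow> bool \<Rightarrow> real) \<Rightarrow> bool list \<Rightarrow> bool list \<Rightarrow> real" where
  "kron_prob P u v = (\<Prod>k<length u. P (u ! k) (v ! k))"

text \<open>The probability attached to an unordered pair; it is well defined because the
  matrix is symmetric, see \<open>edge_prob_doubleton\<close> below.\<close>

definition edge_prob :: "(bool \<Rightarrow> bool \<Rightarrow> real) \<Rightarrow> bool list set \<Rightarrow> real" where
  "edge_prob P e = (THE p. \<exists>u v. e = {u, v} \<and> p = kron_prob P u v)"

lemma kron_matrix_sym: "kron_matrix \<alpha> \<beta> \<gamma> a b = kron_matrix \<alpha> \<beta> \<gamma> b a"
  by (cases a; cases b) simp_all

lemma edge_prob_doubleton:
  assumes "length u = length v"
  shows "edge_prob (kron_matrix \<alpha> \<beta> \<gamma>) {u, v} = kron_prob (kron_matrix \<alpha> \<beta> \<gamma>) u v"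
proof -
  have "kron_prob (kron_matrix \<alpha> \<beta> \<gamma>) v u = kron_prob (kron_matrix \<alpha> \<beta> \<gamma>) u v"
    unfolding kron_prob_def using assms by (intro prod.cong) (auto intro: kron_matrix_sym)
  then show ?thesis
    unfolding edge_prob_def by (intro the_equality) (auto simp: doubleton_eq_iff)
qed

text \<open>A graph on a vertex set is given by its set of edges.\<close>

definition kronecker_graph :: "nat \<Rightarrow> (bool \<Rightarrow> bool \<Rightarrow> real) \<Rightarrow> bool list set set pmf" where
  "kronecker_graph n P =
     map_pmf (\<lambda>X. {e \<in> vertex_pairs (kron_verts n). X e})
       (Pi_pmf (vertex_pairs (kron_verts n)) False (\<lambda>e. bernoulli_pmf (edge_prob P e)))"

definition aas :: "(nat \<Rightarrow> 'a pmf) \<Rightarrow> (nat \<Rightarrow> 'a \<Rightarrow> bool) \<Rightarrow> bool" where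
  "aas M Q \<longleftrightarrow> (\<lambda>n. measure_pmf.prob (M n) {x. Q n x}) \<longlonglongrightarrow> 1"

definition vdegree :: "'a set set \<Rightarrow> 'a \<Rightarrow> nat" where
  "vdegree E v = card {e \<in> E. v \<in> e}"

definition num_degree :: "'a set \<Rightarrow> 'a set set \<Rightarrow> nat \<Rightarrow> nat" where
  "num_degree V E d = card {v \<in> V. vdegree E v = d}"

text \<open>For a single finite graph, ``approximately'' is read as: up to relative error
  \<open>\<epsilon>\<close>, for all degrees \<open>1 \<le> d \<le> D\<close>. The members of a sequence of graphs with power law
  constants \<open>c\<close> and \<open>\<tau>\<close> eventually satisfy this for all \<open>\<epsilon> > 0\<close> and \<open>D\<close>, with \<open>c\<^sub>0 = c\<close>.
  The bound \<open>c\<^sub>0\<close> keeps \<open>c\<close> from vanishing as the graphs grow, so that each fixed degree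
  is attained by a linear fraction of the vertices.\<close>

definition power_law_approx :: "real \<Rightarrow> real \<Rightarrow> nat \<Rightarrow> 'a set \<Rightarrow> 'a set set \<Rightarrow> bool" where
  "power_law_approx c\<^sub>0 \<epsilon> D V E \<longleftrightarrow>
     (\<exists>c \<tau> :: real. c \<ge> c\<^sub>0 \<and>
        (\<forall>d\<in>{1..D}. \<bar>real (num_degree V E d) - c * real d powr (- \<tau>) * real (card V)\<bar>
                       \<le> \<epsilon> * (c * real d powr (- \<tau>) * real (card V))))"

end

theory Submission
  imports Defs
begin

text \<open>
  A vertex with \<open>i\<close> ones has expected degree about \<open>\<mu> = (\<alpha> + \<beta>) ^ i * (\<beta> + \<gamma>) ^ (n - i)\<close>.

  Unless \<open>\<alpha> + \<beta> = \<beta> + \<gamma> = 1\<close>, the logarithm of \<open>\<mu>\<close> is a nontrivial linear form in \<open>i\<close> and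
  \<open>n - i\<close>, so it is bounded for only boundedly many \<open>i\<close>, each carrying a fraction
  \<open>O(1 / sqrt n)\<close> of the vertices. Hence almost all vertices have expected degree tending to
  \<open>0\<close> or to infinity; either way they have degree \<open>1\<close> with vanishing probability, and degree
  \<open>1\<close> is attained by a vanishing fraction of the vertices.

  If \<open>\<alpha> + \<beta> = \<beta> + \<gamma> = 1\<close>, all expected degrees tend to \<open>1\<close> and all edge probabilities to
  \<open>0\<close>, so the degrees are asymptotically Poisson with mean \<open>1\<close>. By a second moment argument
  the fraction of vertices of degree \<open>d\<close> tends to \<open>exp (- 1) / fact d\<close> in probability. A power
  law would force the squared fraction for degree \<open>2\<close> to be close to the product of those for
  degrees \<open>1\<close> and \<open>4\<close>, but \<open>(1 / 2)\<^sup>2\<close> is far from \<open>1 * (1 / 24)\<close>.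
\<close>

section \<open>Sums of independent Bernoulli variables\<close>

definition bernoulli_sum :: "('a \<Rightarrow> real) \<Rightarrow> 'a set \<Rightarrow> nat pmf" where
  "bernoulli_sum p S =
     map_pmf (\<lambda>X. card {e \<in> S. X e}) (Pi_pmf S False (\<lambda>e. bernoulli_pmf (p e)))"

text \<open>If \<open>w\<close> lists the point masses of a variable, this lists those of the
  variable plus one. The value 0 at 0 lets later formulas treat \<open>d = 0\<close>
  uniformly.\<close>

fun shift_weight :: "(nat \<Rightarrow> real) \<Rightarrow> nat \<Rightarrow> real" where
  "shift_weight w 0 = 0"
| "shift_weight w (Suc d) = w d"

lemma bernoulli_sum_empty: "bernoulli_sum p {} = return_pmf 0"
  by (simp add: bernoulli_sum_def)

text \<open>Condition on the variable at \<open>x\<close>: failure leaves the count over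
  \<open>S\<close> as it is, success raises it by one. All inductions on Bernoulli sums below rest
  on this recursion.\<close>

lemma pmf_bernoulli_sum_insert:
  assumes "finite S" "x \<notin> S" "0 \<le> p x" "p x \<le> 1"
  shows "pmf (bernoulli_sum p (insert x S)) d =
           (1 - p x) * pmf (bernoulli_sum p S) d + p x * shift_weight (pmf (bernoulli_sum p S)) d"
proof -
  have card: "card {e \<in> insert x S. (f(x := b)) e} = (if b then Suc else id) (card {e \<in> S. f e})" for f b
  proof -
    have "{e \<in> insert x S. (f(x := b)) e} = (if b then insert x else id) {e \<in> S. f e}"
      using assms(2) by auto
    then show ?thesis using assms(1,2) by auto
  qed
  have eq: "bernoulli_sum p (insert x S) =
      bernoulli_pmf (p x) \<bind> (\<lambda>b. map_pmf (if b then Suc else id) (bernoulli_sum p S))"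
    unfolding bernoulli_sum_def Pi_pmf_insert[OF assms(1,2)] pair_pmf_def
    by (simp only: map_bind_pmf bind_map_pmf map_pmf_comp map_return_pmf case_prod_conv card)
       (simp add: map_pmf_def bind_assoc_pmf bind_return_pmf)
  have Suc: "pmf (map_pmf Suc M) d = shift_weight (pmf M) d" for M
  proof (cases d)
    case 0
    then show ?thesis by (auto simp: pmf_eq_0_set_pmf)
  next
    case (Suc k)
    then show ?thesis by (simp add: pmf_map_inj')
  qed
  show ?thesis
    unfolding eq pmf_bind using assms(3,4) by (simp add: Suc)
qed

text \<open>Each factor obeys \<open>1 - p x \<le> exp (- p x)\<close>.\<close>

lemma bernoulli_sum_0_le:
  assumes "finite S" "\<And>e. e \<in> S \<Longrightarrow> 0 \<le> p e \<and> p e \<le> 1"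
  shows "pmf (bernoulli_sum p S) 0 \<le> exp (- sum p S)"
  using assms
proof (induction S rule: finite_induct)
  case empty
  then show ?case by (simp add: bernoulli_sum_empty)
next
  case (insert x S)
  have "(1 - p x) * pmf (bernoulli_sum p S) 0 \<le> exp (- p x) * exp (- sum p S)"
    using insert.prems insert.IH exp_ge_add_one_self[of "- p x"] by (intro mult_mono) auto
  then show ?case
    using insert by (simp add: pmf_bernoulli_sum_insert exp_diff exp_minus field_simps exp_add)
qed

text \<open>If exactly \<open>x\<close> succeeds, the remaining failures cost
  \<open>exp (- (sum p S - p x))\<close>; as \<open>p x \<le> 1\<close>, the missing
  \<open>p x\<close> is absorbed by the factor \<open>exp 1\<close>.\<close>

lemma bernoulli_sum_1_le:
  assumes "finite S" "\<And>e. e \<in> S \<Longrightarrow> 0 \<le> p e \<and> p e \<le> 1"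
  shows "pmf (bernoulli_sum p S) 1 \<le> exp 1 * sum p S * exp (- sum p S)"
  using assms
proof (induction S rule: finite_induct)
  case empty
  then show ?case by (simp add: bernoulli_sum_empty)
next
  case (insert x S)
  have px: "0 \<le> p x" "p x \<le> 1" using insert.prems by auto
  have "(1 - p x) * pmf (bernoulli_sum p S) 1 \<le> exp (- p x) * (exp 1 * sum p S * exp (- sum p S))"
    using insert.prems insert.IH exp_ge_add_one_self[of "- p x"] by (intro mult_mono) auto
  \<comment> \<open>The bound is weakened by \<open>exp (1 - p x) \<ge> 1\<close> so that both
    contributions add up to exactly the claimed right-hand side.\<close>
  moreover have "pmf (bernoulli_sum p S) 0 \<le> exp (1 - p x) * exp (- sum p S)"
  proof -
    have "pmf (bernoulli_sum p S) 0 \<le> 1 * exp (- sum p S)"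
      using bernoulli_sum_0_le[of S p] insert by simp
    also have "\<dots> \<le> exp (1 - p x) * exp (- sum p S)"
      using px by (intro mult_right_mono) auto
    finally show ?thesis .
  qed
  then have "p x * pmf (bernoulli_sum p S) 0 \<le> p x * (exp (1 - p x) * exp (- sum p S))"
    using px by (intro mult_left_mono)
  moreover have "exp (- p x) * (exp 1 * sum p S * exp (- sum p S)) + p x * (exp (1 - p x) * exp (- sum p S))
      = exp 1 * sum p (insert x S) * exp (- sum p (insert x S))"
    using insert by (simp add: exp_diff exp_minus field_simps exp_add)
  ultimately show ?case
    using insert px by (simp add: pmf_bernoulli_sum_insert)
qed

section \<open>Poisson weights and Poisson approximation\<close>

definition poisson_weight :: "real \<Rightarrow> nat \<Rightarrow> real" where
  "poisson_weight \<mu> d = exp (- \<mu>) * \<mu> ^ d / fact d"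

lemma poisson_weight_nonneg: "0 \<le> \<mu> \<Longrightarrow> 0 \<le> poisson_weight \<mu> d"
  by (simp add: poisson_weight_def)

text \<open>One term of the exponential series, whose terms are nonnegative here, is at most its
  sum.\<close>

lemma poisson_weight_le_1:
  assumes "0 \<le> \<mu>"
  shows "poisson_weight \<mu> d \<le> 1"
proof -
  have "(\<lambda>n. \<mu> ^ n /\<^sub>R fact n) sums exp \<mu>" by (rule exp_converges)
  then have "(\<Sum>n\<in>{d}. \<mu> ^ n /\<^sub>R fact n) \<le> exp \<mu>"
    using assms by (intro sum_le_suminf[THEN order_trans[OF _ eq_refl[OF sums_unique[symmetric]]]])
       (auto simp: sums_iff)
  then show ?thesis
    by (simp add: poisson_weight_def exp_minus field_simps)
qed

lemma shift_weight_bounds: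
  assumes "\<And>d. 0 \<le> w d \<and> w d \<le> 1"
  shows "0 \<le> shift_weight w d \<and> shift_weight w d \<le> 1"
  using assms by (cases d) auto

text \<open>Differentiation in the mean acts as shift minus identity. This matches the recursion for
  Bernoulli sums to first order.\<close>

lemma poisson_weight_deriv:
  "((\<lambda>\<mu>. poisson_weight \<mu> d) has_real_derivative
      shift_weight (poisson_weight \<mu>) d - poisson_weight \<mu> d) (at \<mu>)"
proof (cases d)
  case 0
  then show ?thesis
    unfolding poisson_weight_def by (auto intro!: derivative_eq_intros)
next
  case (Suc k)
  have "((\<lambda>x. x ^ Suc k) has_real_derivative real (Suc k) * \<mu> ^ k) (at \<mu>)"
    using DERIV_pow[of "Suc k" \<mu> UNIV] by simp
  moreover have "((\<lambda>x. exp (- x)) has_real_derivative - exp (- \<mu>)) (at \<mu>)"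
    by (auto intro!: derivative_eq_intros)
  ultimately have "((\<lambda>x. exp (- x) * x ^ Suc k / fact (Suc k)) has_real_derivative
      (- exp (- \<mu>) * \<mu> ^ Suc k + real (Suc k) * \<mu> ^ k * exp (- \<mu>)) / fact (Suc k)) (at \<mu>)"
    by (intro DERIV_cdivide DERIV_mult)
  moreover have "(- exp (- \<mu>) * \<mu> ^ Suc k + real (Suc k) * \<mu> ^ k * exp (- \<mu>)) / fact (Suc k)
      = exp (- \<mu>) * \<mu> ^ k / fact k - exp (- \<mu>) * \<mu> ^ Suc k / fact (Suc k)"
    by (simp add: add_divide_distrib diff_divide_distrib del: power_Suc of_nat_Suc)
  ultimately show ?thesis
    unfolding Suc poisson_weight_def shift_weight.simps by simp
qed

lemma shift_poisson_weight_deriv: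
  "((\<lambda>\<mu>. shift_weight (poisson_weight \<mu>) d) has_real_derivative
      shift_weight (shift_weight (poisson_weight \<mu>)) d - shift_weight (poisson_weight \<mu>) d) (at \<mu>)"
  by (cases d) (auto intro: poisson_weight_deriv)

text \<open>Adding an independent Bernoulli(\<open>q\<close>) variable to a Poisson variable yields
  the first-order Taylor polynomial of the weight at \<open>\<mu> + q\<close>. The second derivative
  is a second difference of numbers in [0, 1], hence at most 2 in absolute value, and the remainder
  is at most \<open>q\<^sup>2\<close>.\<close>

lemma poisson_weight_step:
  assumes "0 \<le> \<mu>" "0 \<le> q"
  shows "\<bar>(1 - q) * poisson_weight \<mu> d + q * shift_weight (poisson_weight \<mu>) d
            - poisson_weight (\<mu> + q) d\<bar> \<le> q\<^sup>2"
proof (cases "q = 0")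
  case False
  then have q: "q > 0" using assms by simp
  define f where "f = (\<lambda>x. poisson_weight x d)"
  define f1 where "f1 = (\<lambda>x. shift_weight (poisson_weight x) d - poisson_weight x d)"
  define f2 where "f2 = (\<lambda>x. (shift_weight (shift_weight (poisson_weight x)) d
    - shift_weight (poisson_weight x) d) - (shift_weight (poisson_weight x) d - poisson_weight x d))"
  define diff where "diff = (\<lambda>n::nat. if n = 0 then f else if n = 1 then f1 else f2)"
  have "(f has_real_derivative f1 t) (at t)" "(f1 has_real_derivative f2 t) (at t)" for t
    unfolding f_def f1_def f2_def
    by (intro poisson_weight_deriv DERIV_diff shift_poisson_weight_deriv)+
  then have "\<forall>m t. m < 2 \<and> \<mu> \<le> t \<and> t \<le> \<mu> + q \<longrightarrow> (diff m has_real_derivative diff (Suc m) t) (at t)"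
    by (auto simp: less_2_cases_iff diff_def)
  \<comment> \<open>The expansion needs a nondegenerate interval, hence the case split on
    \<open>q = 0\<close>.\<close>
  from Taylor_up[OF _ _ this, of f \<mu>] obtain t where t: "\<mu> < t" "t < \<mu> + q"
    "f (\<mu> + q) = (\<Sum>m<2. diff m \<mu> / fact m * (\<mu> + q - \<mu>) ^ m) + diff 2 t / fact 2 * (\<mu> + q - \<mu>)\<^sup>2"
    using q by (auto simp: diff_def)
  have "f (\<mu> + q) = f \<mu> + f1 \<mu> * q + f2 t / 2 * q\<^sup>2"
    using t(3) by (simp add: diff_def eval_nat_numeral lessThan_Suc)
  then have "(1 - q) * f \<mu> + q * shift_weight (poisson_weight \<mu>) d - f (\<mu> + q) = - (f2 t / 2) * q\<^sup>2"
    by (simp add: f1_def f_def algebra_simps)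
  moreover have "\<bar>f2 t / 2\<bar> \<le> 1"
  proof -
    have "0 \<le> t" using t assms by simp
    note b = poisson_weight_nonneg[OF this] poisson_weight_le_1[OF this]
    have "0 \<le> poisson_weight t d \<and> poisson_weight t d \<le> 1" using b by simp
    moreover have "0 \<le> shift_weight (poisson_weight t) d \<and> shift_weight (poisson_weight t) d \<le> 1"
      using b by (intro shift_weight_bounds) auto
    moreover have "0 \<le> shift_weight (shift_weight (poisson_weight t)) d
        \<and> shift_weight (shift_weight (poisson_weight t)) d \<le> 1"
      using b by (intro shift_weight_bounds) auto
    ultimately show ?thesis unfolding f2_def by (simp add: abs_le_iff)
  qed
  then have "\<bar>- (f2 t / 2) * q\<^sup>2\<bar> \<le> 1 * q\<^sup>2"
    unfolding abs_mult by (intro mult_mono) auto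
  ultimately show ?thesis by (simp add: f_def)
qed (simp add: poisson_weight_def)

text \<open>A bound of Le Cam type. Inserting \<open>x\<close> forms a convex combination of the old
  errors at \<open>d\<close> and \<open>d - 1\<close>, so these do not grow, and replacing the
  Bernoulli variable by a Poisson increment adds at most \<open>(p x)\<^sup>2\<close>.\<close>

lemma bernoulli_sum_poisson:
  assumes "finite S" "\<And>e. e \<in> S \<Longrightarrow> 0 \<le> p e \<and> p e \<le> 1"
  shows "\<bar>pmf (bernoulli_sum p S) d - poisson_weight (sum p S) d\<bar> \<le> (\<Sum>e\<in>S. (p e)\<^sup>2)"
  using assms
proof (induction S arbitrary: d rule: finite_induct)
  case empty
  then show ?case by (cases d) (simp_all add: bernoulli_sum_empty poisson_weight_def)
next
  case (insert x S)
  let ?F = "pmf (bernoulli_sum p S)" and ?G = "poisson_weight (sum p S)" and ?R = "\<Sum>e\<in>S. (p e)\<^sup>2"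
  have px: "0 \<le> p x" "p x \<le> 1" using insert.prems by auto
  have IH: "\<bar>?F d - ?G d\<bar> \<le> ?R" for d using insert by auto
  have "0 \<le> ?R" by (intro sum_nonneg) auto
  then have IH': "\<bar>shift_weight ?F d - shift_weight ?G d\<bar> \<le> ?R" using IH by (cases d) auto
  have "\<bar>(1 - p x) * (?F d - ?G d) + p x * (shift_weight ?F d - shift_weight ?G d)\<bar>
      \<le> (1 - p x) * ?R + p x * ?R"
    using px IH IH' by (intro abs_triangle_ineq[THEN order_trans] add_mono)
       (auto simp: abs_mult intro!: mult_left_mono)
  moreover have "\<bar>(1 - p x) * ?G d + p x * shift_weight ?G d - poisson_weight (sum p S + p x) d\<bar> \<le> (p x)\<^sup>2"
    using px insert.prems by (intro poisson_weight_step sum_nonneg) auto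
  ultimately have "\<bar>((1 - p x) * ?F d + p x * shift_weight ?F d) - poisson_weight (sum p S + p x) d\<bar>
      \<le> (1 - p x) * ?R + p x * ?R + (p x)\<^sup>2"
    unfolding abs_le_iff by (simp add: algebra_simps)
  then show ?case
    using insert px by (simp add: pmf_bernoulli_sum_insert algebra_simps)
qed

section \<open>Counts over subsets of a product space\<close>

lemma map_Pi_pmf_bernoulli_count:
  assumes "finite A" "S \<subseteq> A"
  shows "map_pmf (\<lambda>X. card {e \<in> S. X e}) (Pi_pmf A False (\<lambda>e. bernoulli_pmf (p e))) = bernoulli_sum p S"
  unfolding bernoulli_sum_def Pi_pmf_subset[OF assms, of False] map_pmf_comp
  by (intro map_pmf_cong refl) (auto intro: arg_cong[where f = card])

lemma prob_Pi_pmf_bernoulli_count: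
  assumes "finite A" "S \<subseteq> A"
  shows "measure_pmf.prob (Pi_pmf A False (\<lambda>e. bernoulli_pmf (p e))) {X. card {e \<in> S. X e} = d}
       = pmf (bernoulli_sum p S) d"
  unfolding map_Pi_pmf_bernoulli_count[OF assms, symmetric] pmf_map vimage_def by simp

text \<open>The product measure splits into factors over \<open>S\<close> and \<open>A - S\<close>;
  since \<open>T\<close> lies in the latter, the two counts depend on different factors.\<close>

lemma prob_Pi_pmf_bernoulli_count_disjoint:
  assumes "finite A" "S \<subseteq> A" "T \<subseteq> A" "S \<inter> T = {}"
  shows "measure_pmf.prob (Pi_pmf A False (\<lambda>e. bernoulli_pmf (p e)))
           {X. card {e \<in> S. X e} = d \<and> card {e \<in> T. X e} = d'}
       = pmf (bernoulli_sum p S) d * pmf (bernoulli_sum p T) d'"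
proof -
  let ?P = "\<lambda>B. Pi_pmf B False (\<lambda>e. bernoulli_pmf (p e))"
  have A: "A = S \<union> (A - S)" using assms by auto
  have fin: "finite S" "finite (A - S)" using assms by (auto dest: finite_subset)
  let ?h = "\<lambda>(f, g) x. if x \<in> S then f x else g x :: bool"
  have "?P A = map_pmf ?h (pair_pmf (?P S) (?P (A - S)))"
    by (subst A, rule Pi_pmf_union) (use fin in auto)
  then have "map_pmf (\<lambda>X. (card {e \<in> S. X e}, card {e \<in> T. X e})) (?P A)
      = map_pmf (\<lambda>(f, g). (card {e \<in> S. f e}, card {e \<in> T. g e})) (pair_pmf (?P S) (?P (A - S)))"
    unfolding map_pmf_comp
    using assms(4) by (auto simp: map_pmf_comp intro!: map_pmf_cong arg_cong[where f = card])
  also have "\<dots> = pair_pmf (bernoulli_sum p S) (bernoulli_sum p T)"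
    using assms fin by (subst map_pair) (subst (1 2) map_Pi_pmf_bernoulli_count, auto)
  finally have "pmf (map_pmf (\<lambda>X. (card {e \<in> S. X e}, card {e \<in> T. X e})) (?P A)) (d, d')
      = pmf (bernoulli_sum p S) d * pmf (bernoulli_sum p T) d'"
    by (simp add: pmf_pair)
  then show ?thesis by (simp add: pmf_map vimage_def)
qed

lemma prob_Pi_pmf_bernoulli_component:
  assumes "finite A" "e \<in> A" "0 \<le> p e" "p e \<le> 1"
  shows "measure_pmf.prob (Pi_pmf A False (\<lambda>e. bernoulli_pmf (p e))) {X. X e} = p e"
proof -
  have "measure_pmf.prob (Pi_pmf A False (\<lambda>e. bernoulli_pmf (p e))) {X. X e}
      = pmf (map_pmf (\<lambda>X. X e) (Pi_pmf A False (\<lambda>e. bernoulli_pmf (p e)))) True"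
    by (simp add: pmf_map vimage_def)
  then show ?thesis using assms by (simp add: Pi_pmf_component)
qed

section \<open>Moment bounds for counting variables\<close>

lemma integrable_measure_pmf_bounded:
  fixes f :: "'a \<Rightarrow> real"
  assumes "\<And>x. \<bar>f x\<bar> \<le> B"
  shows "integrable (measure_pmf M) f"
  using assms by (intro measure_pmf.integrable_const_bound[of _ B]) auto

lemma expectation_of_bool:
  "measure_pmf.expectation M (\<lambda>x. of_bool (Q x)) = measure_pmf.prob M {x. Q x}"
proof -
  have "(\<lambda>x. of_bool (Q x)) = (indicator {x. Q x} :: _ \<Rightarrow> real)"
    by (auto simp: indicator_def)
  then show ?thesis by simp
qed

lemma real_card_filter: "finite V \<Longrightarrow> real (card {v \<in> V. Q v}) = (\<Sum>v\<in>V. of_bool (Q v))"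
  by (simp add: of_bool_def sum.If_cases Int_def)

lemma expectation_card_filter:
  assumes "finite V"
  shows "measure_pmf.expectation M (\<lambda>x. real (card {v \<in> V. Q v x}))
       = (\<Sum>v\<in>V. measure_pmf.prob M {x. Q v x})"
  unfolding real_card_filter[OF assms] expectation_of_bool[symmetric]
  by (intro Bochner_Integration.integral_sum integrable_measure_pmf_bounded[of _ 1]) auto

text \<open>Markov's inequality for a sum of indicators.\<close>

lemma prob_card_filter_ge:
  assumes "finite V" "t > 0"
  shows "measure_pmf.prob M {x. real (card {v \<in> V. Q v x}) \<ge> t}
       \<le> (\<Sum>v\<in>V. measure_pmf.prob M {x. Q v x}) / t"
proof -
  have "integrable (measure_pmf M) (\<lambda>x. real (card {v \<in> V. Q v x}))"
    using assms by (intro integrable_measure_pmf_bounded[of _ "real (card V)"]) (auto intro: card_mono)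
  from integral_Markov_inequality_measure[OF this, of UNIV t] assms show ?thesis
    by (simp add: expectation_card_filter)
qed

text \<open>Chebyshev's argument, centred at the common approximate probability \<open>g\<close>
  instead of the exact mean. Off-diagonal pairs contribute at most
  \<open>\<kappa> + \<delta>\<^sup>2\<close> each to the second moment; each diagonal pair
  contributes at most 1, which produces the term \<open>1 / card V\<close>.\<close>

lemma prob_card_filter_deviation:
  fixes g \<delta> \<kappa> \<eta> :: real
  assumes "finite V" "V \<noteq> {}" "0 \<le> g" "g \<le> 1" "0 < \<eta>" "0 \<le> \<kappa>"
    and near: "\<And>v. v \<in> V \<Longrightarrow> \<bar>measure_pmf.prob M {x. Q v x} - g\<bar> \<le> \<delta>"
    and joint: "\<And>u v. u \<in> V \<Longrightarrow> v \<in> V \<Longrightarrow> u \<noteq> v \<Longrightarrow>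
      measure_pmf.prob M {x. Q u x \<and> Q v x}
        \<le> measure_pmf.prob M {x. Q u x} * measure_pmf.prob M {x. Q v x} + \<kappa>"
  shows "measure_pmf.prob M {x. \<bar>real (card {v \<in> V. Q v x}) - g * card V\<bar> \<ge> \<eta> * card V}
       \<le> (\<kappa> + \<delta>\<^sup>2 + 1 / card V) / \<eta>\<^sup>2"
proof -
  define P where "P = (\<lambda>v. measure_pmf.prob M {x. Q v x})"
  define c where "c = real (card V)"
  have c: "c > 0" using assms by (auto simp: c_def card_gt_0_iff)
  have P: "0 \<le> P v" "P v \<le> 1" for v by (auto simp: P_def)
  let ?i = "\<lambda>v x. of_bool (Q v x) - g :: real"
  have bound: "\<bar>?i v x\<bar> \<le> 1" for v x using assms by auto
  have int: "integrable (measure_pmf M) (\<lambda>x. ?i u x * ?i v x)" for u v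
    using mult_mono[OF bound bound] by (intro integrable_measure_pmf_bounded[of _ 1]) (simp add: abs_mult)
  have E: "measure_pmf.expectation M (\<lambda>x. ?i u x * ?i v x)
      = measure_pmf.prob M {x. Q u x \<and> Q v x} - g * P u - g * P v + g\<^sup>2" for u v
  proof -
    have "(\<lambda>x. ?i u x * ?i v x)
        = (\<lambda>x. of_bool (Q u x \<and> Q v x) - g * of_bool (Q u x) - g * of_bool (Q v x) + g\<^sup>2)"
      by (auto simp: fun_eq_iff power2_eq_square algebra_simps)
    moreover have "integrable (measure_pmf M) (\<lambda>x. of_bool (R x) :: real)" for R
      by (intro integrable_measure_pmf_bounded[of _ 1]) auto
    ultimately show ?thesis by (simp add: expectation_of_bool P_def)
  qed
  have sq: "(real (card {v \<in> V. Q v x}) - g * c)\<^sup>2 = (\<Sum>u\<in>V. \<Sum>v\<in>V. ?i u x * ?i v x)" for x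
    unfolding real_card_filter[OF assms(1)] sum_product[symmetric] power2_eq_square c_def
    by (simp add: sum_subtractf mult.commute)
  have term_le: "measure_pmf.expectation M (\<lambda>x. ?i u x * ?i v x) \<le> \<kappa> + \<delta>\<^sup>2 + of_bool (u = v)"
    if "u \<in> V" "v \<in> V" for u v
  proof (cases "u = v")
    case True
    have "measure_pmf.expectation M (\<lambda>x. ?i u x * ?i u x) \<le> measure_pmf.expectation M (\<lambda>x. 1)"
    proof (intro integral_mono)
      show "?i u x * ?i u x \<le> 1" for x
        using bound[of u x] by (simp add: abs_square_le_1 flip: power2_eq_square)
    qed (use int in auto)
    also have "\<dots> \<le> \<kappa> + \<delta>\<^sup>2 + 1" using assms by simp
    finally show ?thesis using True by simp
  next
    case False
    \<comment> \<open>The mixed moment is the covariance, at most \<open>\<kappa>\<close>, plus this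
      product of the two biases.\<close>
    have "(P u - g) * (P v - g) \<le> \<bar>P u - g\<bar> * \<bar>P v - g\<bar>"
      by (metis abs_ge_self abs_mult)
    also have "\<dots> \<le> \<delta> * \<delta>"
      using near[OF that(1)] near[OF that(2)] by (intro mult_mono) (auto simp: P_def)
    finally have "(P u - g) * (P v - g) \<le> \<delta>\<^sup>2" by (simp add: power2_eq_square)
    moreover have "measure_pmf.prob M {x. Q u x \<and> Q v x} \<le> P u * P v + \<kappa>"
      using joint[OF that False] by (simp add: P_def)
    ultimately show ?thesis
      unfolding E using False by (simp add: algebra_simps power2_eq_square)
  qed
  have "measure_pmf.expectation M (\<lambda>x. (real (card {v \<in> V. Q v x}) - g * c)\<^sup>2)
      = (\<Sum>u\<in>V. \<Sum>v\<in>V. measure_pmf.expectation M (\<lambda>x. ?i u x * ?i v x))"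
    unfolding sq using int by (subst Bochner_Integration.integral_sum) (auto intro!: sum.cong)
  also have "\<dots> \<le> (\<Sum>u\<in>V. \<Sum>v\<in>V. \<kappa> + \<delta>\<^sup>2 + of_bool (u = v))"
    using term_le by (intro sum_mono) auto
  also have "\<dots> = (\<kappa> + \<delta>\<^sup>2) * c\<^sup>2 + c"
    using assms(1) by (simp add: sum.distrib c_def power2_eq_square of_bool_def algebra_simps)
  finally have mom: "measure_pmf.expectation M (\<lambda>x. (real (card {v \<in> V. Q v x}) - g * c)\<^sup>2)
      \<le> (\<kappa> + \<delta>\<^sup>2) * c\<^sup>2 + c" .
  have int_sq: "integrable (measure_pmf M) (\<lambda>x. (real (card {v \<in> V. Q v x}) - g * c)\<^sup>2)"
    unfolding sq by (intro Bochner_Integration.integrable_sum int)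
  have "\<bar>real (card {v \<in> V. Q v x}) - g * c\<bar> \<ge> \<eta> * c \<longleftrightarrow>
      (real (card {v \<in> V. Q v x}) - g * c)\<^sup>2 \<ge> (\<eta> * c)\<^sup>2" for x
    using abs_le_square_iff[of "\<eta> * c"] c assms by simp
  then have "measure_pmf.prob M {x. \<bar>real (card {v \<in> V. Q v x}) - g * c\<bar> \<ge> \<eta> * c}
     = measure_pmf.prob M {x. (real (card {v \<in> V. Q v x}) - g * c)\<^sup>2 \<ge> (\<eta> * c)\<^sup>2}"
    by simp
  also have "\<dots> \<le> measure_pmf.expectation M (\<lambda>x. (real (card {v \<in> V. Q v x}) - g * c)\<^sup>2) / (\<eta> * c)\<^sup>2"
    using integral_Markov_inequality_measure[OF int_sq, of UNIV "(\<eta> * c)\<^sup>2"] c assms(5) by simp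
  also have "\<dots> \<le> ((\<kappa> + \<delta>\<^sup>2) * c\<^sup>2 + c) / (\<eta> * c)\<^sup>2"
    using mom by (intro divide_right_mono) auto
  also have "\<dots> = (\<kappa> + \<delta>\<^sup>2 + 1 / c) / \<eta>\<^sup>2"
    using c assms by (simp add: field_simps power2_eq_square)
  finally show ?thesis unfolding c_def .
qed

section \<open>Binary strings and vertex pairs\<close>

lemma finite_kron_verts: "finite (kron_verts n)"
  using finite_lists_length_eq[of "UNIV :: bool set" n] by (simp add: kron_verts_def)

lemma card_kron_verts: "card (kron_verts n) = 2 ^ n"
  using card_lists_length_eq[of "UNIV :: bool set" n] by (simp add: kron_verts_def)

lemma kron_verts_Suc: "kron_verts (Suc n) = (#) True ` kron_verts n \<union> (#) False ` kron_verts n"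
  unfolding kron_verts_def by (auto simp: length_Suc_conv)

lemma sum_kron_verts_Suc:
  "(\<Sum>u\<in>kron_verts (Suc n). f u) = (\<Sum>u\<in>kron_verts n. f (True # u)) + (\<Sum>u\<in>kron_verts n. f (False # u))"
  unfolding kron_verts_Suc by (subst sum.union_disjoint) (auto simp: finite_kron_verts sum.reindex)

text \<open>Splitting on the first digit reproduces Pascal's rule.\<close>

lemma card_kron_verts_count:
  "card {u \<in> kron_verts n. count_list u True = i} = n choose i"
proof (induction n arbitrary: i)
  case 0
  have "{u \<in> kron_verts 0. count_list u True = i} = (if i = 0 then {[]} else {})"
    by (auto simp: kron_verts_def)
  then show ?case by auto
next
  case (Suc n)
  have "{u \<in> kron_verts (Suc n). count_list u True = i}
      = (#) True ` {u \<in> kron_verts n. Suc (count_list u True) = i} \<union> (#) False ` {u \<in> kron_verts n. count_list u True = i}"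
    by (auto simp: kron_verts_Suc)
  also have "card \<dots> = card {u \<in> kron_verts n. Suc (count_list u True) = i} + (n choose i)"
    by (subst card_Un_disjoint) (auto simp: card_image Suc.IH finite_kron_verts)
  also have "card {u \<in> kron_verts n. Suc (count_list u True) = i} + (n choose i) = Suc n choose i"
    by (cases i) (auto simp: Suc.IH)
  finally show ?case .
qed

lemma count_list_bool_length: "count_list u True + count_list u False = length u"
  by (induction u) auto

lemma kron_prob_Cons: "kron_prob P (x # u) (y # v) = P x y * kron_prob P u v"
  unfolding kron_prob_def by (simp add: prod.lessThan_Suc_shift del: prod.lessThan_Suc)

text \<open>The sum factorises over the digits of \<open>u\<close>: a one contributes
  \<open>\<alpha> + \<beta>\<close>, a zero \<open>\<beta> + \<gamma>\<close>. The loop term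
  \<open>v = u\<close> is included and is subtracted later by means of
  \<open>kron_prob_self\<close>.\<close>

lemma sum_kron_prob:
  "(\<Sum>v\<in>kron_verts (length u). kron_prob (kron_matrix \<alpha> \<beta> \<gamma>) u v)
     = (\<alpha> + \<beta>) ^ count_list u True * (\<beta> + \<gamma>) ^ count_list u False"
proof (induction u)
  case Nil
  then show ?case by (simp add: kron_verts_def kron_prob_def)
next
  case (Cons x u)
  then show ?case
    by (cases x) (simp_all add: sum_kron_verts_Suc kron_prob_Cons sum_distrib_left[symmetric] algebra_simps)
qed

lemma kron_prob_self:
  "kron_prob (kron_matrix \<alpha> \<beta> \<gamma>) u u = \<alpha> ^ count_list u True * \<gamma> ^ count_list u False"
proof (induction u)
  case Nil
  then show ?case by (simp add: kron_prob_def)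
next
  case (Cons x u)
  then show ?case by (cases x) (simp_all add: kron_prob_Cons)
qed

lemma kron_prob_bounds:
  assumes "\<And>a b. 0 \<le> P a b \<and> P a b \<le> m"
  shows "0 \<le> kron_prob P u v \<and> kron_prob P u v \<le> m ^ length u"
  unfolding kron_prob_def using assms prod_mono[of "{..<length u}" "\<lambda>k. P (u ! k) (v ! k)" "\<lambda>_. m"]
  by (auto intro!: prod_nonneg)

section \<open>Potential edges at a vertex\<close>

definition star_pairs :: "'a set \<Rightarrow> 'a \<Rightarrow> 'a set set" where
  "star_pairs V u = {e \<in> vertex_pairs V. u \<in> e}"

lemma finite_vertex_pairs: "finite V \<Longrightarrow> finite (vertex_pairs V)"
  by (rule finite_subset[of _ "Pow V"]) (auto simp: vertex_pairs_def)

lemma star_pairs_subset: "star_pairs V u \<subseteq> vertex_pairs V"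
  by (auto simp: star_pairs_def)

lemma star_pairs_eq: "u \<in> V \<Longrightarrow> star_pairs V u = (\<lambda>v. {u, v}) ` (V - {u})"
  by (auto simp: star_pairs_def vertex_pairs_def)

text \<open>Two stars with distinct centres share at most the pair joining them; this is the only
  source of dependence between two degrees.\<close>

lemma star_pairs_Int: "u \<noteq> v \<Longrightarrow> (star_pairs V u - {{u, v}}) \<inter> (star_pairs V v - {{u, v}}) = {}"
  by (auto simp: star_pairs_def vertex_pairs_def)

lemma sum_star_pairs: "u \<in> V \<Longrightarrow> (\<Sum>e\<in>star_pairs V u. f e) = (\<Sum>v\<in>V - {u}. f {u, v})"
  unfolding star_pairs_eq by (subst sum.reindex) (auto simp: inj_on_def doubleton_eq_iff)

lemma vdegree_filter: "vdegree {e \<in> vertex_pairs V. X e} u = card {e \<in> star_pairs V u. X e}"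
  unfolding vdegree_def star_pairs_def by (rule arg_cong[where f = card]) auto

section \<open>The typical expected degree\<close>

text \<open>Consecutive central binomials have ratio \<open>2 * (2 * k + 1) / (k + 1)\<close>, so
  the induction reduces to \<open>(2 * k + 1) * (2 * k + 3) \<le> 4 * (k + 1)\<^sup>2\<close>. This
  gives the order \<open>4 ^ k / sqrt k\<close> without Stirling's formula.\<close>

lemma central_binomial_square_le: "(real (2 * k choose k))\<^sup>2 * (2 * real k + 1) \<le> 16 ^ k"
proof (induction k)
  case (Suc k)
  let ?b = "real (2 * k choose k)" and ?b' = "real (2 * Suc k choose Suc k)"
  have "Suc k * (2 * Suc k choose Suc k) = 2 * Suc k * (Suc (2 * k) choose k)"
    using binomial_absorption[of k "2 * Suc k"] by simp
  moreover have "Suc k * (Suc (2 * k) choose k) = Suc (2 * k) * (2 * k choose k)"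
    using Suc_times_binomial_eq[of "2 * k" k] binomial_symmetric[of k "Suc (2 * k)"]
    by (simp add: mult.commute)
  ultimately have "Suc k * (2 * Suc k choose Suc k) = 2 * (Suc (2 * k) * (2 * k choose k))"
    by (metis mult.assoc)
  then have "real (Suc k * (2 * Suc k choose Suc k)) = real (2 * (Suc (2 * k) * (2 * k choose k)))"
    by (rule arg_cong)
  then have "(real k + 1) * ?b' = 2 * (2 * real k + 1) * ?b"
    by (simp only: of_nat_mult of_nat_Suc of_nat_numeral) (simp only: algebra_simps)
  then have "((real k + 1) * ?b')\<^sup>2 = (2 * (2 * real k + 1) * ?b)\<^sup>2"
    by (rule arg_cong)
  then have sq: "(real k + 1)\<^sup>2 * ?b'\<^sup>2 = 4 * (2 * real k + 1)\<^sup>2 * ?b\<^sup>2"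
    by (simp only: power_mult_distrib) simp
  have "(real k + 1)\<^sup>2 * (?b'\<^sup>2 * (2 * real (Suc k) + 1))
      = (4 * (2 * real k + 1) * (2 * real k + 3)) * (?b\<^sup>2 * (2 * real k + 1))"
    unfolding mult.assoc[symmetric] sq by (simp add: power2_eq_square algebra_simps)
  also have "\<dots> \<le> (16 * (real k + 1)\<^sup>2) * 16 ^ k"
  proof (rule mult_mono)
    show "4 * (2 * real k + 1) * (2 * real k + 3) \<le> 16 * (real k + 1)\<^sup>2"
      by (simp add: power2_eq_square algebra_simps)
  qed (use Suc.IH in auto)
  finally have "(real k + 1)\<^sup>2 * (?b'\<^sup>2 * (2 * real (Suc k) + 1)) \<le> (real k + 1)\<^sup>2 * 16 ^ Suc k"
    by (simp add: algebra_simps)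
  then show ?case by (rule mult_left_le_imp_le) simp
qed simp

text \<open>For \<open>n = 2 * k\<close> this is the square root of the previous bound. For
  \<open>n = 2 * k + 1\<close>, Pascal's rule bounds the coefficient by twice the central one for
  \<open>2 * k\<close>.\<close>

lemma middle_binomial_le: "real (n choose (n div 2)) \<le> 2 ^ n / sqrt n" if "n > 0"
proof -
  define k where "k = n div 2"
  have even: "real (2 * k choose k) * sqrt (2 * real k + 1) \<le> 4 ^ k"
  proof (rule power2_le_imp_le)
    show "(real (2 * k choose k) * sqrt (2 * real k + 1))\<^sup>2 \<le> (4 ^ k)\<^sup>2"
    proof -
      have "((4::real) ^ k)\<^sup>2 = 16 ^ k"
        by (simp add: power2_eq_square flip: power_mult_distrib)
      then show ?thesis
        using central_binomial_square_le[of k] by (simp add: power_mult_distrib)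
    qed
  qed simp
  have le: "real (n choose k) * sqrt (2 * real k + 1) \<le> 2 ^ n"
  proof (cases "even n")
    case True
    then have "n = 2 * k" by (simp add: k_def)
    then show ?thesis using even by (simp add: power_mult)
  next
    case False
    then have n: "n = Suc (2 * k)" by (simp add: k_def)
    have "n choose k \<le> 2 * (2 * k choose k)"
    proof (cases k)
      case (Suc j)
      then have "n choose k = (2 * k choose j) + (2 * k choose k)" unfolding n by simp
      then show ?thesis using binomial_maximum'[of k j] by simp
    qed (simp add: n)
    then have "real (n choose k) \<le> 2 * real (2 * k choose k)" by linarith
    then have "real (n choose k) * sqrt (2 * real k + 1) \<le> 2 * real (2 * k choose k) * sqrt (2 * real k + 1)"
      by (intro mult_right_mono) auto
    also have "\<dots> \<le> 2 * 4 ^ k" using even by simp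
    finally show ?thesis by (simp add: n power_mult)
  qed
  have "real (n choose k) * sqrt n \<le> real (n choose k) * sqrt (2 * real k + 1)"
    by (intro mult_left_mono) (auto simp: k_def)
  with le have "real (n choose k) * sqrt n \<le> 2 ^ n" by linarith
  then show ?thesis using that by (simp add: field_simps k_def)
qed

lemma middle_binomial_tendsto: "(\<lambda>n. real (n choose (n div 2)) / 2 ^ n) \<longlonglongrightarrow> 0"
proof (rule tendsto_sandwich[OF _ _ tendsto_const])
  show "\<forall>\<^sub>F n in sequentially. real (n choose (n div 2)) / 2 ^ n \<le> 1 / sqrt n"
    using eventually_gt_at_top[of 0]
    by eventually_elim (use middle_binomial_le in \<open>simp add: field_simps\<close>)
  show "(\<lambda>n. 1 / sqrt (real n)) \<longlonglongrightarrow> 0"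
    by (intro tendsto_divide_0[OF tendsto_const] filterlim_at_top_imp_at_infinity
        filterlim_compose[OF sqrt_at_top filterlim_real_sequentially])
qed auto

lemma card_le_of_diff_le:
  fixes S :: "nat set"
  assumes "finite S" "\<And>i j. i \<in> S \<Longrightarrow> j \<in> S \<Longrightarrow> j - i \<le> L"
  shows "card S \<le> Suc L"
proof (cases "S = {}")
  case False
  have "S \<subseteq> {Min S..Min S + L}"
  proof
    fix j assume j: "j \<in> S"
    have "Min S \<le> j" "j - Min S \<le> L"
      using assms j False by (auto intro: Min_le assms(2))
    then show "j \<in> {Min S..Min S + L}" by auto
  qed
  then have "card S \<le> card {Min S..Min S + L}" by (rule card_mono[rotated]) simp
  then show ?thesis by simp
qed simp

text \<open>If \<open>x = y\<close>, the form equals \<open>n * y\<close> and leaves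
  \<open>[-K, K]\<close> for large \<open>n\<close>. Otherwise unit steps in \<open>i\<close> change
  it by \<open>x - y\<close>, so admissible indices are at most
  \<open>2 * K / \<bar>x - y\<bar>\<close> apart. In both cases \<open>L\<close> does not depend on
  \<open>n\<close>.\<close>

lemma eventually_few_small_combinations:
  fixes x y K :: real
  assumes "x \<noteq> 0 \<or> y \<noteq> 0"
  obtains L where
    "\<forall>\<^sub>F n in sequentially. card {i \<in> {..n}. \<bar>real i * x + real (n - i) * y\<bar> \<le> K} \<le> L"
proof (cases "x = y")
  case True
  have "y \<noteq> 0" using True assms by auto
  have "\<forall>\<^sub>F n in sequentially. real n > K / \<bar>y\<bar>"
    using filterlim_real_sequentially by (simp add: filterlim_at_top_dense)
  then have "\<forall>\<^sub>F n in sequentially. card {i \<in> {..n}. \<bar>real i * x + real (n - i) * y\<bar> \<le> K} \<le> 0"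
  proof eventually_elim
    case (elim n)
    then have "K < real n * \<bar>y\<bar>" using \<open>y \<noteq> 0\<close> by (simp add: field_simps)
    then have "K < \<bar>real i * x + real (n - i) * y\<bar>" if "i \<le> n" for i
      using True that by (simp add: abs_mult of_nat_diff flip: distrib_right)
    then have "{i \<in> {..n}. \<bar>real i * x + real (n - i) * y\<bar> \<le> K} = {}" by force
    then show ?case by (metis card.empty order_refl)
  qed
  then show ?thesis by (rule that)
next
  case False
  define L where "L = nat \<lceil>2 * K / \<bar>x - y\<bar>\<rceil>"
  have "card {i \<in> {..n}. \<bar>real i * x + real (n - i) * y\<bar> \<le> K} \<le> Suc L" for n
  proof (rule card_le_of_diff_le)
    fix i j assume ij: "i \<in> {i \<in> {..n}. \<bar>real i * x + real (n - i) * y\<bar> \<le> K}"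
      "j \<in> {i \<in> {..n}. \<bar>real i * x + real (n - i) * y\<bar> \<le> K}"
    have "(real j - real i) * (x - y)
        = (real j * x + real (n - j) * y) - (real i * x + real (n - i) * y)"
      using ij by (simp add: of_nat_diff algebra_simps)
    then have "\<bar>(real j - real i) * (x - y)\<bar> \<le> 2 * K" using ij by auto
    moreover have "(real j - real i) * \<bar>x - y\<bar> \<le> \<bar>(real j - real i) * (x - y)\<bar>"
      unfolding abs_mult by (intro mult_right_mono) auto
    ultimately have "(real j - real i) * \<bar>x - y\<bar> \<le> 2 * K" by linarith
    then have "real j - real i \<le> 2 * K / \<bar>x - y\<bar>" using False by (simp add: field_simps)
    then show "j - i \<le> L" unfolding L_def by linarith
  qed simp
  then show ?thesis by (intro that[of "Suc L"]) simp
qed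

text \<open>The right-hand side is twice the minimum of \<open>x\<close> and \<open>1 / x\<close>.
  Large \<open>x\<close> is covered by \<open>x\<^sup>2 / 2 \<le> exp x\<close>, small
  \<open>x\<close> by \<open>exp (- x) \<le> 1\<close>.\<close>

lemma mult_exp_minus_le:
  fixes x :: real
  assumes "x > 0"
  shows "x * exp (- x) \<le> 2 * exp (- \<bar>ln x\<bar>)"
proof (cases "x \<ge> 1")
  case True
  have "x\<^sup>2 / 2 \<le> exp x" using exp_lower_Taylor_quadratic[of x] assms by simp
  then show ?thesis
    using True assms by (simp add: exp_minus field_simps power2_eq_square)
next
  case False
  have "x * exp (- x) \<le> x * 1" using assms by (intro mult_left_mono) auto
  also have "\<dots> \<le> 2 * exp (- \<bar>ln x\<bar>)" using False assms by simp
  finally show ?thesis .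
qed

text \<open>Strings on which the form is at most \<open>K\<close> in absolute value occupy at most
  \<open>L\<close> levels, each no larger than the middle binomial coefficient, hence a vanishing
  fraction. Every other string contributes less than \<open>exp (- K)\<close>.\<close>

lemma mean_exp_minus_abs_tendsto:
  fixes x y :: real
  assumes "x \<noteq> 0 \<or> y \<noteq> 0"
  shows "(\<lambda>n. (\<Sum>u\<in>kron_verts n. exp (- \<bar>real (count_list u True) * x + real (count_list u False) * y\<bar>)) / 2 ^ n)
      \<longlonglongrightarrow> 0" (is "(\<lambda>n. ?S n / 2 ^ n) \<longlonglongrightarrow> 0")
proof (rule LIMSEQ_I)
  fix r :: real assume "r > 0"
  \<comment> \<open>Chosen so that strings outside the exceptional levels account for at most half
    of \<open>r\<close>.\<close>
  define K where "K = - ln (r / 2)"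
  have K: "exp (- K) = r / 2" using \<open>r > 0\<close> by (simp add: K_def)
  obtain L where L: "\<forall>\<^sub>F n in sequentially.
      card {i \<in> {..n}. \<bar>real i * x + real (n - i) * y\<bar> \<le> K} \<le> L"
    using eventually_few_small_combinations[OF assms] .
  have "(\<lambda>n. real L * (real (n choose (n div 2)) / 2 ^ n)) \<longlonglongrightarrow> real L * 0"
    by (intro tendsto_intros middle_binomial_tendsto)
  then have "\<forall>\<^sub>F n in sequentially. real L * (real (n choose (n div 2)) / 2 ^ n) < r / 2"
    using \<open>r > 0\<close> by (intro order_tendstoD) auto
  with L have "\<forall>\<^sub>F n in sequentially. norm (?S n / 2 ^ n - 0) < r"
  proof eventually_elim
    case (elim n)
    define I where "I = {i \<in> {..n}. \<bar>real i * x + real (n - i) * y\<bar> \<le> K}"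
    define B where "B = {u \<in> kron_verts n. count_list u True \<in> I}"
    have fin: "finite I" "finite B" by (auto simp: I_def B_def finite_kron_verts)
    have "B = (\<Union>i\<in>I. {u \<in> kron_verts n. count_list u True = i})" by (auto simp: B_def)
    then have "card B \<le> (\<Sum>i\<in>I. card {u \<in> kron_verts n. count_list u True = i})"
      using card_UN_le[OF fin(1)] by simp
    also have "\<dots> \<le> (\<Sum>i\<in>I. n choose (n div 2))"
      unfolding card_kron_verts_count by (intro sum_mono binomial_maximum)
    also have "\<dots> \<le> L * (n choose (n div 2))"
      using elim(1) by (simp add: I_def)
    finally have B: "real (card B) \<le> real L * real (n choose (n div 2))"
      by (simp flip: of_nat_mult)
    have "?S n \<le> (\<Sum>u\<in>kron_verts n. exp (- K) + of_bool (u \<in> B))"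
    proof (rule sum_mono)
      fix u assume u: "u \<in> kron_verts n"
      then have len: "count_list u True + count_list u False = n"
        using count_list_bool_length[of u] by (simp add: kron_verts_def)
      then have False_eq: "count_list u False = n - count_list u True" and le: "count_list u True \<le> n" by auto
      let ?t = "real (count_list u True) * x + real (count_list u False) * y"
      show "exp (- \<bar>?t\<bar>) \<le> exp (- K) + of_bool (u \<in> B)"
      proof (cases "u \<in> B")
        case True
        have "exp (- \<bar>?t\<bar>) \<le> 1" by simp
        then show ?thesis using True by (simp add: add_increasing)
      next
        case False
        then have "K < \<bar>?t\<bar>" using u le by (auto simp: B_def I_def False_eq)
        then show ?thesis using False by simp
      qed
    qed
    also have "\<dots> = 2 ^ n * (r / 2) + card B"
    proof -
      have "kron_verts n \<inter> {u. u \<in> B} = B" by (auto simp: B_def)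
      then show ?thesis
        by (simp add: sum.distrib card_kron_verts K of_bool_def sum.If_cases finite_kron_verts)
    qed
    finally have "?S n / 2 ^ n \<le> (2 ^ n * (r / 2) + real L * real (n choose (n div 2))) / 2 ^ n"
      using B by (intro divide_right_mono) auto
    also have "\<dots> = r / 2 + real L * (real (n choose (n div 2)) / 2 ^ n)"
      by (simp add: add_divide_distrib)
    also have "\<dots> < r" using elim(2) by linarith
    finally have "?S n / 2 ^ n < r" .
    moreover have "?S n / 2 ^ n \<ge> 0" by (intro divide_nonneg_nonneg sum_nonneg) auto
    ultimately show ?case by simp
  qed
  then show "\<exists>no. \<forall>n\<ge>no. norm (?S n / 2 ^ n - 0) < r"
    by (simp add: eventually_sequentially)
qed

section \<open>Degrees in the Kronecker graph\<close>

lemma aas_notI: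
  assumes "(\<lambda>n. measure_pmf.prob (M n) {x. Q n x}) \<longlonglongrightarrow> 0"
  shows "aas M (\<lambda>n x. \<not> Q n x)"
proof -
  have "measure_pmf.prob (M n) {x. \<not> Q n x} = 1 - measure_pmf.prob (M n) {x. Q n x}" for n
    using measure_pmf.prob_compl[of "{x. Q n x}" "M n"] by (simp add: Compl_eq_Diff_UNIV[symmetric] Collect_neg_eq)
  then show ?thesis
    unfolding aas_def using tendsto_diff[OF tendsto_const[of 1] assms] by simp
qed

locale kronecker_params =
  fixes \<alpha> \<beta> \<gamma> :: real
  assumes \<alpha>: "0 < \<alpha>" "\<alpha> < 1" and \<beta>: "0 < \<beta>" "\<beta> < 1" and \<gamma>: "0 < \<gamma>" "\<gamma> < 1"
begin

abbreviation "P \<equiv> kron_matrix \<alpha> \<beta> \<gamma>"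

text \<open>The largest matrix entry. As it is below 1, all edge probabilities decay uniformly, at
  least as fast as \<open>m ^ n\<close>.\<close>

definition "m = max \<alpha> (max \<beta> \<gamma>)"

lemma m_bounds: "0 < m" "m < 1"
  using \<alpha> \<beta> \<gamma> by (auto simp: m_def)

lemma kron_matrix_bounds: "0 \<le> P a b \<and> P a b \<le> m"
  using \<alpha> \<beta> \<gamma> by (cases a; cases b) (auto simp: m_def)

lemma edge_prob_bounds:
  assumes "e \<in> vertex_pairs (kron_verts n)"
  shows "0 \<le> edge_prob P e" "edge_prob P e \<le> m ^ n" "edge_prob P e \<le> 1"
proof -
  obtain u v where "e = {u, v}" "length u = n" "length v = n"
    using assms by (auto simp: vertex_pairs_def kron_verts_def)
  then show "0 \<le> edge_prob P e" "edge_prob P e \<le> m ^ n"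
    using kron_prob_bounds[of P m u v, OF kron_matrix_bounds] by (auto simp: edge_prob_doubleton)
  then show "edge_prob P e \<le> 1"
    using power_le_one[of m n] m_bounds by linarith
qed

lemma star_edge_prob_bounds:
  assumes "e \<in> star_pairs (kron_verts n) u"
  shows "0 \<le> edge_prob P e" "edge_prob P e \<le> m ^ n" "edge_prob P e \<le> 1"
  using edge_prob_bounds[OF subsetD[OF star_pairs_subset assms]] by simp_all

lemma finite_star: "finite (star_pairs (kron_verts n) u)"
  by (rule finite_subset[OF star_pairs_subset finite_vertex_pairs[OF finite_kron_verts]])

lemma expected_degree:
  assumes "u \<in> kron_verts n"
  shows "sum (edge_prob P) (star_pairs (kron_verts n) u)
    = (\<alpha> + \<beta>) ^ count_list u True * (\<beta> + \<gamma>) ^ count_list u False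
        - \<alpha> ^ count_list u True * \<gamma> ^ count_list u False"
proof -
  have n: "length u = n" using assms by (simp add: kron_verts_def)
  have "sum (edge_prob P) (star_pairs (kron_verts n) u) = (\<Sum>v\<in>kron_verts n - {u}. kron_prob P u v)"
    unfolding sum_star_pairs[OF assms]
    using n by (intro sum.cong refl edge_prob_doubleton) (auto simp: kron_verts_def)
  also have "\<dots> = (\<Sum>v\<in>kron_verts n. kron_prob P u v) - kron_prob P u u"
    using assms by (simp add: sum_diff1 finite_kron_verts)
  finally show ?thesis
    unfolding kron_prob_self using sum_kron_prob[where u = u and \<alpha> = \<alpha> and \<beta> = \<beta> and \<gamma> = \<gamma>] n by simp
qed

lemma prob_kronecker_graph:
  "measure_pmf.prob (kronecker_graph n P) {E. Q E} =
     measure_pmf.prob (Pi_pmf (vertex_pairs (kron_verts n)) False (\<lambda>e. bernoulli_pmf (edge_prob P e)))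
       {X. Q {e \<in> vertex_pairs (kron_verts n). X e}}"
  unfolding kronecker_graph_def by (simp add: vimage_def)

lemma prob_degree:
  "measure_pmf.prob (kronecker_graph n P) {E. vdegree E u = d}
     = pmf (bernoulli_sum (edge_prob P) (star_pairs (kron_verts n) u)) d"
  unfolding prob_kronecker_graph vdegree_filter
  by (intro prob_Pi_pmf_bernoulli_count finite_vertex_pairs finite_kron_verts star_pairs_subset)

text \<open>Off the event that \<open>{u, v}\<close> is an edge, the two degrees are sums over disjoint sets
  of pairs, hence independent.\<close>

lemma prob_degree_joint:
  assumes "u \<in> kron_verts n" "v \<in> kron_verts n" "u \<noteq> v"
  shows "measure_pmf.prob (kronecker_graph n P) {E. vdegree E u = d \<and> vdegree E v = d}
    \<le> measure_pmf.prob (kronecker_graph n P) {E. vdegree E u = d}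
      * measure_pmf.prob (kronecker_graph n P) {E. vdegree E v = d} + 4 * m ^ n"
proof -
  let ?A = "vertex_pairs (kron_verts n)"
  let ?M = "Pi_pmf ?A False (\<lambda>e. bernoulli_pmf (edge_prob P e))"
  let ?pr = "measure_pmf.prob ?M"
  define e where "e = {u, v}"
  define S where "S = (\<lambda>w. star_pairs (kron_verts n) w)"
  define q where "q = ?pr {X. X e}"
  have fin: "finite ?A" by (intro finite_vertex_pairs finite_kron_verts)
  have e: "e \<in> ?A" using assms by (auto simp: vertex_pairs_def e_def)
  have q: "q \<le> m ^ n" "0 \<le> q" "q \<le> 1"
    using prob_Pi_pmf_bernoulli_component[OF fin e, of "edge_prob P"] edge_prob_bounds[OF e]
    unfolding q_def by simp_all
  define cnt where "cnt = (\<lambda>w X. card {x \<in> S w. X x})"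
  define cnt' where "cnt' = (\<lambda>w X. card {x \<in> S w - {e}. X x})"
  have drop: "cnt w X = cnt' w X" if "\<not> X e" for w X
    unfolding cnt_def cnt'_def using that by (intro arg_cong[where f = card]) auto
  have single: "?pr {X. cnt' w X = d} \<le> ?pr {X. cnt w X = d} + q" for w
  proof -
    have "?pr {X. cnt' w X = d} \<le> ?pr ({X. cnt w X = d} \<union> {X. X e})"
      by (rule measure_pmf.finite_measure_mono) (auto simp: drop)
    also have "\<dots> \<le> ?pr {X. cnt w X = d} + ?pr {X. X e}"
      by (rule measure_Un_le) auto
    finally show ?thesis by (simp add: q_def)
  qed
  have "?pr {X. cnt u X = d \<and> cnt v X = d}
      \<le> ?pr ({X. cnt' u X = d \<and> cnt' v X = d} \<union> {X. X e})"
    by (rule measure_pmf.finite_measure_mono) (auto simp: drop)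
  also have "\<dots> \<le> ?pr {X. cnt' u X = d \<and> cnt' v X = d} + q"
    unfolding q_def by (rule measure_Un_le) auto
  also have "?pr {X. cnt' u X = d \<and> cnt' v X = d}
      = ?pr {X. cnt' u X = d} * ?pr {X. cnt' v X = d}"
  proof -
    have sub: "S w - {e} \<subseteq> ?A" for w by (auto simp: S_def star_pairs_def)
    have disj: "(S u - {e}) \<inter> (S v - {e}) = {}"
      unfolding S_def e_def by (rule star_pairs_Int[OF assms(3)])
    show ?thesis
      unfolding cnt'_def prob_Pi_pmf_bernoulli_count_disjoint[OF fin sub sub disj]
        prob_Pi_pmf_bernoulli_count[OF fin sub] ..
  qed
  also have "\<dots> \<le> (?pr {X. cnt u X = d} + q) * (?pr {X. cnt v X = d} + q)"
    using q by (intro mult_mono single) auto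
  \<comment> \<open>Expanding leaves three error terms of size at most \<open>q\<close>; with the
    \<open>q\<close> from discarding the event \<open>X e\<close> this makes four.\<close>
  also have "\<dots> \<le> ?pr {X. cnt u X = d} * ?pr {X. cnt v X = d} + 3 * q"
  proof -
    have "a * b + q * a + q * b + q * q \<le> a * b + q * 1 + q * 1 + q * 1"
      if "0 \<le> a" "a \<le> 1" "b \<le> 1" for a b :: real
      using q that by (intro add_mono mult_left_mono) auto
    from this[of "?pr {X. cnt u X = d}" "?pr {X. cnt v X = d}"]
    show ?thesis by (simp add: algebra_simps)
  qed
  finally show ?thesis
    using q(1) unfolding prob_kronecker_graph vdegree_filter cnt_def S_def by simp
qed

section \<open>The critical case\<close>

lemma degree_deviation_critical:
  assumes "\<alpha> + \<beta> = 1" "\<beta> + \<gamma> = 1" "\<eta> > 0"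
  shows "(\<lambda>n. measure_pmf.prob (kronecker_graph n P)
      {E. \<bar>real (num_degree (kron_verts n) E d) - poisson_weight 1 d * 2 ^ n\<bar> \<ge> \<eta> * 2 ^ n}) \<longlonglongrightarrow> 0"
proof -
  have \<gamma>_eq: "\<gamma> = \<alpha>" using assms by simp
  \<comment> \<open>The first summand bounds the Poisson approximation error; the second accounts
    for the mean being \<open>1 - \<alpha> ^ n\<close> instead of 1, because loops are
    excluded.\<close>
  define \<delta> where "\<delta> = (\<lambda>n. m ^ n + \<bar>poisson_weight (1 - \<alpha> ^ n) d - poisson_weight 1 d\<bar>)"
  have near: "\<bar>measure_pmf.prob (kronecker_graph n P) {E. vdegree E u = d} - poisson_weight 1 d\<bar> \<le> \<delta> n"
    if u: "u \<in> kron_verts n" for n u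
  proof -
    let ?S = "star_pairs (kron_verts n) u"
    have "count_list u True + count_list u False = n"
      using u count_list_bool_length[of u] by (simp add: kron_verts_def)
    then have mean: "sum (edge_prob P) ?S = 1 - \<alpha> ^ n"
      unfolding expected_degree[OF u] assms(1,2) unfolding \<gamma>_eq by (simp flip: power_add)
    \<comment> \<open>One factor of each square is bounded uniformly by \<open>m ^ n\<close>; the
      others sum to the mean, which is at most 1.\<close>
    have "(\<Sum>e\<in>?S. (edge_prob P e)\<^sup>2) \<le> (\<Sum>e\<in>?S. m ^ n * edge_prob P e)"
      unfolding power2_eq_square by (intro sum_mono mult_right_mono star_edge_prob_bounds)
    also have "\<dots> = m ^ n * (1 - \<alpha> ^ n)" by (simp add: sum_distrib_left[symmetric] mean)
    also have "\<dots> \<le> m ^ n * 1" using m_bounds \<alpha> by (intro mult_left_mono) auto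
    finally have "(\<Sum>e\<in>?S. (edge_prob P e)\<^sup>2) \<le> m ^ n" by simp
    moreover have "\<bar>pmf (bernoulli_sum (edge_prob P) ?S) d - poisson_weight (sum (edge_prob P) ?S) d\<bar>
        \<le> (\<Sum>e\<in>?S. (edge_prob P e)\<^sup>2)"
      using star_edge_prob_bounds by (intro bernoulli_sum_poisson finite_star conjI)
    ultimately have "\<bar>pmf (bernoulli_sum (edge_prob P) ?S) d - poisson_weight (1 - \<alpha> ^ n) d\<bar> \<le> m ^ n"
      unfolding mean by linarith
    then show ?thesis unfolding prob_degree \<delta>_def by linarith
  qed
  have bound: "measure_pmf.prob (kronecker_graph n P)
      {E. \<bar>real (num_degree (kron_verts n) E d) - poisson_weight 1 d * 2 ^ n\<bar> \<ge> \<eta> * 2 ^ n}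
      \<le> (4 * m ^ n + (\<delta> n)\<^sup>2 + 1 / 2 ^ n) / \<eta>\<^sup>2" for n
  proof -
    have "kron_verts n \<noteq> {}" using card_kron_verts[of n] by auto
    then have "measure_pmf.prob (kronecker_graph n P)
      {E. \<bar>real (card {v \<in> kron_verts n. vdegree E v = d}) - poisson_weight 1 d * card (kron_verts n)\<bar>
           \<ge> \<eta> * card (kron_verts n)}
      \<le> (4 * m ^ n + (\<delta> n)\<^sup>2 + 1 / card (kron_verts n)) / \<eta>\<^sup>2"
      using assms m_bounds
      by (intro prob_card_filter_deviation near prob_degree_joint finite_kron_verts
          poisson_weight_nonneg poisson_weight_le_1) auto
    then show ?thesis by (simp add: card_kron_verts num_degree_def)
  qed
  have "(\<lambda>n. m ^ n) \<longlonglongrightarrow> 0" "(\<lambda>n. \<alpha> ^ n) \<longlonglongrightarrow> 0" "(\<lambda>n. (1 / 2) ^ n :: real) \<longlonglongrightarrow> 0"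
    using m_bounds \<alpha> by (auto intro!: LIMSEQ_power_zero)
  note lim = this
  have "isCont (\<lambda>x. poisson_weight x d) 1"
    using poisson_weight_deriv by (rule DERIV_isCont)
  moreover have "(\<lambda>n. 1 - \<alpha> ^ n) \<longlonglongrightarrow> 1"
    using tendsto_diff[OF tendsto_const[of 1] lim(2)] by simp
  ultimately have "(\<lambda>n. poisson_weight (1 - \<alpha> ^ n) d) \<longlonglongrightarrow> poisson_weight 1 d"
    by (rule isCont_tendsto_compose)
  then have "(\<lambda>n. \<bar>poisson_weight (1 - \<alpha> ^ n) d - poisson_weight 1 d\<bar>) \<longlonglongrightarrow> 0"
    by (intro tendsto_rabs_zero) (simp add: LIM_zero)
  from tendsto_add[OF lim(1) this] have "\<delta> \<longlonglongrightarrow> 0" by (simp add: \<delta>_def)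
  then have "(\<lambda>n. (4 * m ^ n + (\<delta> n)\<^sup>2 + (1 / 2) ^ n) / \<eta>\<^sup>2) \<longlonglongrightarrow> (4 * 0 + 0\<^sup>2 + 0) / \<eta>\<^sup>2"
    using m_bounds assms by (intro tendsto_intros) auto
  then have "(\<lambda>n. (4 * m ^ n + (\<delta> n)\<^sup>2 + 1 / 2 ^ n) / \<eta>\<^sup>2) \<longlonglongrightarrow> 0"
    by (simp add: power_divide)
  then show ?thesis
    by (rule tendsto_sandwich[OF _ _ tendsto_const, rotated 2]) (use bound in auto)
qed

text \<open>The values \<open>x d\<close> of any power law satisfy
  \<open>x 1 * x 4 = x 2 * x 2\<close>, whatever \<open>c\<close> and \<open>\<tau>\<close> are. The
  Poisson weights violate this by a factor of 6, enough to survive the relative error 1/4 and the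
  deviations \<open>\<eta>\<close>.\<close>

lemma not_power_law_critical:
  assumes "\<alpha> + \<beta> = 1" "\<beta> + \<gamma> = 1" "c\<^sub>0 > 0"
  shows "aas (\<lambda>n. kronecker_graph n P) (\<lambda>n E. \<not> power_law_approx c\<^sub>0 (1 / 4) 4 (kron_verts n) E)"
proof (rule aas_notI)
  \<comment> \<open>Half the Poisson weight of degree 4, so that the weights of degrees 1, 2 and 4
    are 48, 24 and 2 times \<open>\<eta>\<close>.\<close>
  define \<eta> :: real where "\<eta> = exp (- 1) / 48"
  define bad where "bad = (\<lambda>n d. {E. \<bar>real (num_degree (kron_verts n) E d) - poisson_weight 1 d * 2 ^ n\<bar> \<ge> \<eta> * 2 ^ n})"
  have "{E. power_law_approx c\<^sub>0 (1 / 4) 4 (kron_verts n) E} \<subseteq> bad n 1 \<union> bad n 2 \<union> bad n 4" for n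
  proof (rule ccontr)
    assume "\<not> ?thesis"
    then obtain E where E: "power_law_approx c\<^sub>0 (1 / 4) 4 (kron_verts n) E"
      "E \<notin> bad n 1" "E \<notin> bad n 2" "E \<notin> bad n 4" by auto
    define N where "N = (\<lambda>d. real (num_degree (kron_verts n) E d))"
    define z :: real where "z = exp (- 1) * 2 ^ n / 48"
    have z: "z > 0" by (simp add: z_def)
    from E(1) obtain c \<tau> where c: "c \<ge> c\<^sub>0"
      and app: "\<forall>d\<in>{1..4}. \<bar>N d - c * real d powr (- \<tau>) * 2 ^ n\<bar> \<le> 1 / 4 * (c * real d powr (- \<tau>) * 2 ^ n)"
      unfolding power_law_approx_def N_def card_kron_verts of_nat_power of_nat_numeral by blast
    define x where "x = (\<lambda>d::nat. c * real d powr (- \<tau>) * 2 ^ n)"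
    have x0: "x d \<ge> 0" for d using c assms by (simp add: x_def)
    have "(4::real) powr (- \<tau>) = (2 * 2) powr (- \<tau>)" by simp
    also have "\<dots> = 2 powr (- \<tau>) * 2 powr (- \<tau>)" by (rule powr_mult)
    finally have x: "x 1 * x 4 = x 2 * x 2" by (simp add: x_def)
    have "\<eta> * 2 ^ n = z" "poisson_weight 1 1 * 2 ^ n = 48 * z" "poisson_weight 1 2 * 2 ^ n = 24 * z"
      "poisson_weight 1 4 * 2 ^ n = 2 * z"
      by (simp_all add: z_def \<eta>_def poisson_weight_def fact_numeral)
    with E(2-4) have "\<bar>N 1 - 48 * z\<bar> < z" "\<bar>N 2 - 24 * z\<bar> < z" "\<bar>N 4 - 2 * z\<bar> < z"
      by (simp_all add: bad_def N_def)
    then have N: "N 1 \<le> 49 * z" "N 4 \<le> 3 * z" "23 * z \<le> N 2"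
      by linarith+
    have "\<bar>N d - x d\<bar> \<le> 1 / 4 * x d" if "d \<in> {1..4}" for d
      using app that unfolding x_def by blast
    then have "x d \<le> 4 / 3 * N d \<and> N d \<le> 5 / 4 * x d" if "d \<in> {1..4}" for d
      using that unfolding abs_le_iff by fastforce
    from this[of 1] this[of 4] this[of 2]
    have a: "x 1 \<le> 4 / 3 * N 1" "x 4 \<le> 4 / 3 * N 4" "N 2 \<le> 5 / 4 * x 2"
      by auto
    have "x 1 \<le> 4 / 3 * (49 * z)" "x 4 \<le> 4 / 3 * (3 * z)" "4 / 5 * (23 * z) \<le> x 2"
      using a N by linarith+
    then have "(4 / 5 * (23 * z)) * (4 / 5 * (23 * z)) \<le> x 2 * x 2"
      "x 1 * x 4 \<le> (4 / 3 * (49 * z)) * (4 / 3 * (3 * z))"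
      using z x0 by (intro mult_mono; simp)+
    \<comment> \<open>The left factor is about 338.6, the right one about 261.3.\<close>
    then have "(z * z) * (8464 / 25) \<le> (z * z) * (784 / 3)"
      unfolding x by simp
    moreover have "z * z > 0" using z by simp
    ultimately show False by linarith
  qed
  note sub = this
  have "measure_pmf.prob (kronecker_graph n P) {E. power_law_approx c\<^sub>0 (1 / 4) 4 (kron_verts n) E}
      \<le> measure_pmf.prob (kronecker_graph n P) (bad n 1) + measure_pmf.prob (kronecker_graph n P) (bad n 2)
         + measure_pmf.prob (kronecker_graph n P) (bad n 4)" for n
  proof -
    let ?pr = "measure_pmf.prob (kronecker_graph n P)"
    have "?pr {E. power_law_approx c\<^sub>0 (1 / 4) 4 (kron_verts n) E} \<le> ?pr (bad n 1 \<union> bad n 2 \<union> bad n 4)"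
      using sub by (rule measure_pmf.finite_measure_mono) simp
    also have "\<dots> \<le> ?pr (bad n 1 \<union> bad n 2) + ?pr (bad n 4)"
      by (rule measure_Un_le) simp_all
    also have "?pr (bad n 1 \<union> bad n 2) \<le> ?pr (bad n 1) + ?pr (bad n 2)"
      by (rule measure_Un_le) simp_all
    finally show ?thesis by simp
  qed
  note bound = this
  have "(\<lambda>n. measure_pmf.prob (kronecker_graph n P) (bad n d)) \<longlonglongrightarrow> 0" for d
    unfolding bad_def using assms by (intro degree_deviation_critical) (auto simp: \<eta>_def)
  from tendsto_add[OF tendsto_add[OF this[of 1] this[of 2]] this[of 4]]
  have "(\<lambda>n. measure_pmf.prob (kronecker_graph n P) (bad n 1) + measure_pmf.prob (kronecker_graph n P) (bad n 2)
         + measure_pmf.prob (kronecker_graph n P) (bad n 4)) \<longlonglongrightarrow> 0" by simp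
  then show "(\<lambda>n. measure_pmf.prob (kronecker_graph n P) {E. power_law_approx c\<^sub>0 (1 / 4) 4 (kron_verts n) E}) \<longlonglongrightarrow> 0"
    by (rule tendsto_sandwich[OF _ _ tendsto_const, rotated 2]) (use bound in auto)
qed

section \<open>The noncritical case\<close>

lemma prob_degree_1_le:
  assumes u: "u \<in> kron_verts n"
  shows "measure_pmf.prob (kronecker_graph n P) {E. vdegree E u = 1}
    \<le> 2 * exp 2 * exp (- \<bar>real (count_list u True) * ln (\<alpha> + \<beta>) + real (count_list u False) * ln (\<beta> + \<gamma>)\<bar>)"
proof -
  let ?S = "star_pairs (kron_verts n) u"
  define l where "l = sum (edge_prob P) ?S"
  define \<mu> where "\<mu> = (\<alpha> + \<beta>) ^ count_list u True * (\<beta> + \<gamma>) ^ count_list u False"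
  define s where "s = \<alpha> ^ count_list u True * \<gamma> ^ count_list u False"
  have l: "l = \<mu> - s" unfolding l_def \<mu>_def s_def expected_degree[OF u] ..
  have s: "0 \<le> s" "s \<le> 1"
    unfolding s_def using \<alpha> \<gamma> by (auto intro!: mult_le_one power_le_one)
  have \<mu>: "0 < \<mu>" unfolding \<mu>_def using \<alpha> \<beta> \<gamma> by auto
  have ln: "ln \<mu> = real (count_list u True) * ln (\<alpha> + \<beta>) + real (count_list u False) * ln (\<beta> + \<gamma>)"
    unfolding \<mu>_def using \<alpha> \<beta> \<gamma> by (simp add: ln_mult ln_realpow)
  have "measure_pmf.prob (kronecker_graph n P) {E. vdegree E u = 1} \<le> exp 1 * l * exp (- l)"
    unfolding prob_degree l_def using star_edge_prob_bounds by (intro bernoulli_sum_1_le finite_star conjI)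
  \<comment> \<open>The loop probability \<open>s\<close> lies in [0, 1], so replacing
    \<open>l\<close> by \<open>\<mu>\<close> costs at most another factor
    \<open>exp 1\<close>.\<close>
  also have "\<dots> \<le> exp 1 * \<mu> * exp (1 - \<mu>)"
    using s \<mu> unfolding l by - (rule mult_mono, auto)
  also have "\<dots> = exp 2 * (\<mu> * exp (- \<mu>))"
    by (simp add: exp_diff exp_minus field_simps flip: exp_add)
  also have "\<dots> \<le> exp 2 * (2 * exp (- \<bar>ln \<mu>\<bar>))"
    using mult_exp_minus_le[OF \<mu>] by (intro mult_left_mono) auto
  finally show ?thesis by (simp add: ln)
qed

text \<open>Degree 1 alone suffices: there the power is 1 for every \<open>\<tau>\<close>, so an
  approximate power law forces at least \<open>c\<^sub>0 / 2 * 2 ^ n\<close> vertices of degree 1.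
  Markov's inequality makes this unlikely.\<close>

lemma not_power_law_noncritical:
  assumes "\<alpha> + \<beta> \<noteq> 1 \<or> \<beta> + \<gamma> \<noteq> 1" "c\<^sub>0 > 0"
  shows "aas (\<lambda>n. kronecker_graph n P) (\<lambda>n E. \<not> power_law_approx c\<^sub>0 (1 / 2) 1 (kron_verts n) E)"
proof (rule aas_notI)
  define S where "S = (\<lambda>n. \<Sum>u\<in>kron_verts n.
    exp (- \<bar>real (count_list u True) * ln (\<alpha> + \<beta>) + real (count_list u False) * ln (\<beta> + \<gamma>)\<bar>))"
  have bound: "measure_pmf.prob (kronecker_graph n P) {E. power_law_approx c\<^sub>0 (1 / 2) 1 (kron_verts n) E}
      \<le> 4 * exp 2 / c\<^sub>0 * (S n / 2 ^ n)" for n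
  proof -
    have sub: "{E. power_law_approx c\<^sub>0 (1 / 2) 1 (kron_verts n) E}
        \<subseteq> {E. real (card {v \<in> kron_verts n. vdegree E v = 1}) \<ge> c\<^sub>0 / 2 * 2 ^ n}"
    proof safe
      fix E assume "power_law_approx c\<^sub>0 (1 / 2) 1 (kron_verts n) E"
      then obtain c where c: "c \<ge> c\<^sub>0"
        "\<bar>real (num_degree (kron_verts n) E 1) - c * 2 ^ n\<bar> \<le> 1 / 2 * (c * 2 ^ n)"
        unfolding power_law_approx_def by (auto simp: card_kron_verts)
      have "c\<^sub>0 * 2 ^ n \<le> c * 2 ^ n" using c by simp
      then show "real (card {v \<in> kron_verts n. vdegree E v = 1}) \<ge> c\<^sub>0 / 2 * 2 ^ n"
        using c(2) unfolding num_degree_def by linarith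
    qed
    have "measure_pmf.prob (kronecker_graph n P) {E. power_law_approx c\<^sub>0 (1 / 2) 1 (kron_verts n) E}
      \<le> measure_pmf.prob (kronecker_graph n P) {E. real (card {v \<in> kron_verts n. vdegree E v = 1}) \<ge> c\<^sub>0 / 2 * 2 ^ n}"
      using sub by (intro measure_pmf.finite_measure_mono) auto
    also have "\<dots> \<le> (\<Sum>v\<in>kron_verts n. measure_pmf.prob (kronecker_graph n P) {E. vdegree E v = 1}) / (c\<^sub>0 / 2 * 2 ^ n)"
      using assms by (intro prob_card_filter_ge finite_kron_verts) auto
    also have "\<dots> \<le> 2 * exp 2 * S n / (c\<^sub>0 / 2 * 2 ^ n)"
      unfolding S_def sum_distrib_left using assms
      by (intro divide_right_mono sum_mono prob_degree_1_le) auto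
    finally show ?thesis by (simp add: field_simps)
  qed
  have "ln (\<alpha> + \<beta>) \<noteq> 0 \<or> ln (\<beta> + \<gamma>) \<noteq> 0"
    using assms \<alpha> \<beta> \<gamma> by (simp add: ln_eq_zero_iff)
  from tendsto_mult[OF tendsto_const[of "4 * exp 2 / c\<^sub>0"] mean_exp_minus_abs_tendsto[OF this]]
  have "(\<lambda>n. 4 * exp 2 / c\<^sub>0 * (S n / 2 ^ n)) \<longlonglongrightarrow> 0" by (simp add: S_def)
  then show "(\<lambda>n. measure_pmf.prob (kronecker_graph n P)
      {E. power_law_approx c\<^sub>0 (1 / 2) 1 (kron_verts n) E}) \<longlonglongrightarrow> 0"
    by (rule tendsto_sandwich[OF _ _ tendsto_const, rotated 2]) (use bound in auto)
qed

end

theorem theorem1: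
  fixes \<alpha> \<beta> \<gamma> :: real
  assumes "0 < \<alpha>" "\<alpha> < 1" and "0 < \<beta>" "\<beta> < 1" and "0 < \<gamma>" "\<gamma> < 1"
  shows "\<forall>c\<^sub>0>0. \<exists>\<epsilon>>0. \<exists>D.
           aas (\<lambda>n. kronecker_graph n (kron_matrix \<alpha> \<beta> \<gamma>))
               (\<lambda>n E. \<not> power_law_approx c\<^sub>0 \<epsilon> D (kron_verts n) E)"
proof -
  interpret kronecker_params \<alpha> \<beta> \<gamma> using assms by unfold_locales
  show ?thesis
  \<comment> \<open>The witnesses for \<open>\<epsilon>\<close> and \<open>D\<close> depend only on
    the case, not on \<open>c\<^sub>0\<close>.\<close>
  proof (cases "\<alpha> + \<beta> = 1 \<and> \<beta> + \<gamma> = 1")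
    case True
    then show ?thesis
      using not_power_law_critical by (intro allI impI exI[of _ "1 / 4 :: real"] conjI exI[of _ 4]) auto
  next
    case False
    then show ?thesis
      using not_power_law_noncritical by (intro allI impI exI[of _ "1 / 2 :: real"] conjI exI[of _ 1]) auto
  qed
qed

end
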